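(* Let $c\neq 0$ and $\lambda>0$ be real constants, let $I\subset\mathbb{R}$ be an open interval on which $\cos\left(\frac{u}{c}\right)\neq0$ and $1-\frac{\lambda^2}{c^2}\sin^2\left(\frac{u}{c}\right)>0$, and let $\rho=\rho(v)$ be a smooth curve parametrized by arclength on the unit sphere $S^2$ of the subspace $\mathbb{E}^3=\mathrm{span}\{e_2,e_3,e_4\}$ of $\mathbb{E}^4$. Then the generalized spherical surface of second kind in $\mathbb{E}^4$ determined by $c,\lambda,\rho$ has flat normal connection, i.e., $K_N=0$.
   Context: Let $e_1,\dots,e_4$ be the standard orthonormal basis of $\mathbb{E}^4$. The generalized spherical surface of second kind determined by $c,\lambda,\rho$ is the surface in $\mathbb{E}^4$ given by $$X(u,v)=\phi(u)\,e_1+\lambda\cos\left(\tfrac uc\right)\rho(v),\qquad \phi(u)=\int\sqrt{1-\tfrac{\lambda^2}{c^2}\sin^2\left(\tfrac uc\right)}\,du,\qquad u\in I$$ (any antiderivative). For a surface in $\mathbb{E}^4$ with orthonormal tangent frame $X_1,X_2$, orthonormal normal frame $N_1,N_2$, second fundamental form $h$ and shape operators $A_{N_\alpha}$ (defined by $\langle A_{N_\alpha}Y,Z\rangle=\langle h(Y,Z),N_\alpha\rangle$), the normal curvature tensor is $R^\perp(X_i,X_j)N_\alpha=h(X_i,A_{N_\alpha}X_j)-h(X_j,A_{N_\alpha}X_i)$, and the normal curvature is $K_N=\left\{\langle R^\perp(X_1,X_2)N_1,N_2\rangle^2\right\}^{1/2}$. The normal connection is flat if and only if $K_N=0$. *)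

theory Defs
  imports "HOL-Analysis.Analysis"
begin

text \<open>Used for open \<open>J\<close> only; \<open>D n\<close> is the \<open>n\<close>-th derivative.\<close>

definition smooth_curve_on :: "real set \<Rightarrow> (real \<Rightarrow> 'a::real_normed_vector) \<Rightarrow> bool" where
  "smooth_curve_on J \<gamma> \<longleftrightarrow>
     (\<exists>D. (\<forall>v\<in>J. D 0 v = \<gamma> v) \<and>
          (\<forall>n::nat. \<forall>v\<in>J. (D n has_vector_derivative D (Suc n) v) (at v)))"

text \<open>
  A parametrized surface is a map \<open>X\<close> on an open subset of the plane; its tangent and normal
  vectors at the parameter point \<open>p\<close> are regarded as vectors of the ambient space. The notions
  below are meaningful at points where \<open>X\<close> is a twice differentiable immersion.
\<close>

definition tangent_space_at :: "(real \<times> real \<Rightarrow> 'a::euclidean_space) \<Rightarrow> real \<times> real \<Rightarrow> 'a set" where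
  "tangent_space_at X p = range (frechet_derivative X (at p))"

definition normal_space_at :: "(real \<times> real \<Rightarrow> 'a::euclidean_space) \<Rightarrow> real \<times> real \<Rightarrow> 'a set" where
  "normal_space_at X p = orthogonal_comp (tangent_space_at X p)"

definition normal_part :: "(real \<times> real \<Rightarrow> 'a::euclidean_space) \<Rightarrow> real \<times> real \<Rightarrow> 'a \<Rightarrow> 'a" where
  "normal_part X p w = (THE n. n \<in> normal_space_at X p \<and> w - n \<in> tangent_space_at X p)"

definition tangent_coords :: "(real \<times> real \<Rightarrow> 'a::euclidean_space) \<Rightarrow> real \<times> real \<Rightarrow> 'a \<Rightarrow> real \<times> real" where
  "tangent_coords X p Y = (THE a. frechet_derivative X (at p) a = Y)"

text \<open>
  By the Gauss formula, \<open>h(Y,Z)\<close> is the normal part of the ambient derivative in direction \<open>Y\<close>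
  of any tangent vector field extending \<open>Z\<close>. The extension used here is the field
  \<open>q \<mapsto> dX\<^sub>q(b)\<close> with constant coordinates \<open>b\<close>, where \<open>Z = dX\<^sub>p(b)\<close>; for the
  coordinate fields this gives the normal parts of the second partial derivatives of \<open>X\<close>.
\<close>

definition second_fundamental_form ::
  "(real \<times> real \<Rightarrow> 'a::euclidean_space) \<Rightarrow> real \<times> real \<Rightarrow> 'a \<Rightarrow> 'a \<Rightarrow> 'a" where
  "second_fundamental_form X p Y Z =
     normal_part X p
       (frechet_derivative (\<lambda>q. frechet_derivative X (at q) (tangent_coords X p Z)) (at p)
          (tangent_coords X p Y))"

definition shape_operator ::
  "(real \<times> real \<Rightarrow> 'a::euclidean_space) \<Rightarrow> real \<times> real \<Rightarrow> 'a \<Rightarrow> 'a \<Rightarrow> 'a" where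
  "shape_operator X p N Y =
     (THE W. W \<in> tangent_space_at X p \<and>
        (\<forall>Z\<in>tangent_space_at X p. inner W Z = inner (second_fundamental_form X p Y Z) N))"

definition normal_curvature_tensor ::
  "(real \<times> real \<Rightarrow> 'a::euclidean_space) \<Rightarrow> real \<times> real \<Rightarrow> 'a \<Rightarrow> 'a \<Rightarrow> 'a \<Rightarrow> 'a" where
  "normal_curvature_tensor X p Y Z N =
     second_fundamental_form X p Y (shape_operator X p N Z)
     - second_fundamental_form X p Z (shape_operator X p N Y)"

definition flat_normal_connection_on ::
  "(real \<times> real) set \<Rightarrow> (real \<times> real \<Rightarrow> 'a::euclidean_space) \<Rightarrow> bool" where
  "flat_normal_connection_on U X \<longleftrightarrow>
     (\<forall>p\<in>U. \<forall>Y\<in>tangent_space_at X p. \<forall>Z\<in>tangent_space_at X p. \<forall>N\<in>normal_space_at X p.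
        normal_curvature_tensor X p Y Z N = 0)"

definition orthonormal_pair_in :: "'a::real_inner set \<Rightarrow> 'a \<Rightarrow> 'a \<Rightarrow> bool" where
  "orthonormal_pair_in V a b \<longleftrightarrow>
     a \<in> V \<and> b \<in> V \<and> norm a = 1 \<and> norm b = 1 \<and> orthogonal a b"

text \<open>
  The normal curvature \<open>K\<^sub>N\<close> at \<open>p\<close>, computed in an orthonormal tangent frame \<open>X1, X2\<close> and an
  orthonormal normal frame \<open>N1, N2\<close> of a surface in four-space; its value does not depend on
  the frames.
\<close>

definition normal_curvature ::
  "(real \<times> real \<Rightarrow> real^4) \<Rightarrow> real \<times> real \<Rightarrow>
   real^4 \<Rightarrow> real^4 \<Rightarrow> real^4 \<Rightarrow> real^4 \<Rightarrow> real" where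
  "normal_curvature X p X1 X2 N1 N2 =
     sqrt ((inner (normal_curvature_tensor X p X1 X2 N1) N2)\<^sup>2)"

text \<open>
  \<open>\<phi>\<close> stands for any antiderivative of \<open>sqrt (1 - lam\<^sup>2 / c\<^sup>2 * (sin (u / c))\<^sup>2)\<close>.
\<close>

definition generalized_spherical_surface_second_kind ::
  "real \<Rightarrow> real \<Rightarrow> (real \<Rightarrow> real) \<Rightarrow> (real \<Rightarrow> real^4) \<Rightarrow> real \<times> real \<Rightarrow> real^4" where
  "generalized_spherical_surface_second_kind c lam \<phi> \<rho> =
     (\<lambda>(u, v). \<phi> u *\<^sub>R axis 1 1 + (lam * cos (u / c)) *\<^sub>R \<rho> v)"

end

theory Submission
  imports Defs
begin

text \<open>
  The coordinate curves of the surface \<open>X(u,v) = a(u) e + b(u) \<rho>(v)\<close> are orthogonal, and they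
  are conjugate: the mixed partial derivative \<open>b'(u) \<rho>'(v)\<close> is a multiple of
  \<open>X\<^sub>v = b(u) \<rho>'(v)\<close>, hence tangent, so that \<open>h(X\<^sub>u, X\<^sub>v) = 0\<close>. Consequently \<open>X\<^sub>u\<close> and \<open>X\<^sub>v\<close>
  are eigenvectors of every shape operator \<open>A\<^sub>N\<close>. All shape operators are thus diagonal in one
  common basis, they commute, and by the Ricci equation the normal curvature tensor vanishes.

  The lemma \<open>orthogonal_conjugate_coordinates_imp_flat\<close> is this argument for an arbitrary
  parametrization with orthogonal and conjugate coordinates. That the coordinates here are
  orthogonal follows by differentiating \<open>\<rho> \<bullet> \<rho> = 1\<close> and \<open>e \<bullet> \<rho> = 0\<close>. The hypotheses on
  \<open>cos (u / c)\<close> and on the radicand give \<open>b \<noteq> 0\<close> and \<open>a' > 0\<close>, which make the surface regular.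
\<close>

section \<open>The normal part of a vector\<close>

lemma orthogonal_comp_Int_eq_0:
  fixes x :: "'a::real_inner"
  assumes "x \<in> V" "x \<in> orthogonal_comp V"
  shows "x = 0"
  using assms by (auto simp: orthogonal_comp_def orthogonal_self)

lemma subspace_tangent_space_at:
  assumes "X differentiable (at p)"
  shows "subspace (tangent_space_at X p)"
  unfolding tangent_space_at_def
  by (rule linear_subspace_image[OF linear_frechet_derivative[OF assms] subspace_UNIV])

lemma normal_part_unique:
  assumes d: "X differentiable (at p)"
    and n: "n \<in> normal_space_at X p" "w - n \<in> tangent_space_at X p"
  shows "normal_part X p w = n"
  unfolding normal_part_def
proof (rule the_equality)
  fix m assume m: "m \<in> normal_space_at X p \<and> w - m \<in> tangent_space_at X p"
  have "(w - n) - (w - m) \<in> tangent_space_at X p"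
    by (rule subspace_diff[OF subspace_tangent_space_at[OF d]]) (use m n in auto)
  then have "m - n \<in> tangent_space_at X p" by simp
  moreover have "m - n \<in> orthogonal_comp (tangent_space_at X p)"
    by (rule subspace_diff[OF subspace_orthogonal_comp])
       (use m n in \<open>auto simp: normal_space_at_def\<close>)
  ultimately have "m - n = 0" by (rule orthogonal_comp_Int_eq_0)
  then show "m = n" by simp
qed (use n in auto)

lemma normal_part_decomposition:
  assumes "X differentiable (at p)"
  shows "normal_part X p w \<in> normal_space_at X p"
    and "w - normal_part X p w \<in> tangent_space_at X p"
proof -
  obtain y z where yz: "y \<in> span (tangent_space_at X p)"
      "\<And>t. t \<in> span (tangent_space_at X p) \<Longrightarrow> orthogonal z t" "w = y + z"
    using orthogonal_subspace_decomp_exists[of "tangent_space_at X p" w] by metis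
  have y: "y \<in> tangent_space_at X p"
    using yz(1) subspace_tangent_space_at[OF assms] by (metis span_eq_iff)
  have z: "z \<in> normal_space_at X p"
    using yz(2) by (auto simp: normal_space_at_def orthogonal_comp_def orthogonal_commute span_base)
  have "normal_part X p w = z"
    using normal_part_unique[OF assms z] y yz(3) by simp
  then show "normal_part X p w \<in> normal_space_at X p"
      "w - normal_part X p w \<in> tangent_space_at X p"
    using y z yz(3) by auto
qed

lemma linear_normal_part:
  assumes d: "X differentiable (at p)"
  shows "linear (normal_part X p)"
proof (rule linearI)
  note T = subspace_tangent_space_at[OF d]
  have N: "subspace (normal_space_at X p)"
    by (simp add: normal_space_at_def subspace_orthogonal_comp)
  note dec = normal_part_decomposition[OF d]
  show "normal_part X p (x + y) = normal_part X p x + normal_part X p y" for x y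
  proof (rule normal_part_unique[OF d])
    show "normal_part X p x + normal_part X p y \<in> normal_space_at X p"
      by (intro subspace_add N dec)
    have "(x - normal_part X p x) + (y - normal_part X p y) \<in> tangent_space_at X p"
      by (intro subspace_add T dec)
    then show "x + y - (normal_part X p x + normal_part X p y) \<in> tangent_space_at X p"
      by (simp add: algebra_simps)
  qed
  show "normal_part X p (r *\<^sub>R x) = r *\<^sub>R normal_part X p x" for r x
  proof (rule normal_part_unique[OF d])
    show "r *\<^sub>R normal_part X p x \<in> normal_space_at X p"
      by (intro subspace_scale N dec)
    show "r *\<^sub>R x - r *\<^sub>R normal_part X p x \<in> tangent_space_at X p"
      using subspace_scale[OF T dec(2)[of x], of r] by (simp add: scaleR_diff_right)
  qed
qed

lemma normal_part_tangent:
  assumes "X differentiable (at p)" "w \<in> tangent_space_at X p"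
  shows "normal_part X p w = 0"
  by (rule normal_part_unique)
     (use assms in \<open>auto simp: normal_space_at_def orthogonal_comp_def orthogonal_def\<close>)

lemma shape_operator_unique:
  assumes d: "X differentiable (at p)"
    and W: "W \<in> tangent_space_at X p"
    and inner_W: "\<And>Z. Z \<in> tangent_space_at X p \<Longrightarrow>
      inner W Z = inner (second_fundamental_form X p Y Z) N"
  shows "shape_operator X p N Y = W"
  unfolding shape_operator_def
proof (rule the_equality)
  fix V assume V: "V \<in> tangent_space_at X p \<and> (\<forall>Z\<in>tangent_space_at X p.
    inner V Z = inner (second_fundamental_form X p Y Z) N)"
  have "V - W \<in> tangent_space_at X p"
    using V W subspace_tangent_space_at[OF d] by (intro subspace_diff) auto
  moreover have "inner (V - W) (V - W) = 0"
    using V inner_W calculation by (simp add: inner_diff_left)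
  ultimately show "V = W" by simp
qed (use W inner_W in auto)

section \<open>Orthogonal conjugate coordinates\<close>

text \<open>
  With \<open>L\<close> and \<open>M\<close> the normal parts of the pure second derivatives, conjugacy leaves
  \<open>h(Y,Z) = y\<^sub>1 z\<^sub>1 L + y\<^sub>2 z\<^sub>2 M\<close> in coordinates. By orthogonality, \<open>A\<^sub>N\<close> multiplies the two
  coordinates by \<open>(L \<bullet> N) / |X\<^sub>u|\<^sup>2\<close> and \<open>(M \<bullet> N) / |X\<^sub>v|\<^sup>2\<close>. Hence \<open>h(Y, A\<^sub>N Z)\<close> is symmetric
  in \<open>Y\<close> and \<open>Z\<close>. Conjugacy is expressed by tangency of the two mixed partial derivatives
  \<open>B\<close> and \<open>B'\<close>.
\<close>

lemma orthogonal_conjugate_coordinates_imp_flat: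
  fixes X Xu Xv :: "real \<times> real \<Rightarrow> 'a::euclidean_space"
  assumes U: "open U" "p \<in> U"
    and dX: "\<And>q. q \<in> U \<Longrightarrow> (X has_derivative (\<lambda>h. fst h *\<^sub>R Xu q + snd h *\<^sub>R Xv q)) (at q)"
    and dXu: "(Xu has_derivative (\<lambda>h. fst h *\<^sub>R A + snd h *\<^sub>R B)) (at p)"
    and dXv: "(Xv has_derivative (\<lambda>h. fst h *\<^sub>R B' + snd h *\<^sub>R C)) (at p)"
    and regular: "Xu p \<noteq> 0" "Xv p \<noteq> 0"
    and orth: "inner (Xu p) (Xv p) = 0"
    and conjugate: "B \<in> span {Xu p, Xv p}" "B' \<in> span {Xu p, Xv p}"
    and Y: "Y \<in> tangent_space_at X p" and Z: "Z \<in> tangent_space_at X p"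
  shows "normal_curvature_tensor X p Y Z N = 0"
proof -
  have diff: "X differentiable (at p)"
    using dX[OF U(2)] by (auto simp: differentiable_def)
  have fd: "frechet_derivative X (at q) = (\<lambda>h. fst h *\<^sub>R Xu q + snd h *\<^sub>R Xv q)" if "q \<in> U" for q
    using frechet_derivative_at[OF dX[OF that]] by simp
  define t where "t h = fst h *\<^sub>R Xu p + snd h *\<^sub>R Xv p" for h :: "real \<times> real"
  have fdp: "frechet_derivative X (at p) = t"
    using fd[OF U(2)] by (simp add: t_def fun_eq_iff)
  have tangent: "tangent_space_at X p = range t"
    by (simp add: tangent_space_at_def fdp)
  have t_in [simp]: "t h \<in> tangent_space_at X p" for h
    by (simp add: tangent)
  have inner_t: "inner (t h) (t k) = fst h * fst k * inner (Xu p) (Xu p)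
      + snd h * snd k * inner (Xv p) (Xv p)" for h k
    using orth inner_commute[of "Xv p" "Xu p"]
    by (simp add: t_def inner_add_left inner_add_right)
  have t_inj: "t h = t k \<longleftrightarrow> h = k" for h k
  proof
    assume eq: "t h = t k"
    have "inner (t h) (t (1,0)) = inner (t k) (t (1,0))"
         "inner (t h) (t (0,1)) = inner (t k) (t (0,1))"
      using eq by simp_all
    then show "h = k" using regular by (simp add: inner_t prod_eq_iff)
  qed simp
  have coords: "tangent_coords X p (t h) = h" for h
    by (simp add: tangent_coords_def fdp t_inj)
  have span_tangent: "span {Xu p, Xv p} \<subseteq> tangent_space_at X p"
  proof (rule span_minimal[OF _ subspace_tangent_space_at[OF diff]])
    show "{Xu p, Xv p} \<subseteq> tangent_space_at X p"
      using t_in[of "(1,0)"] t_in[of "(0,1)"] by (simp add: t_def)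
  qed
  define L where "L = normal_part X p A"
  define M where "M = normal_part X p C"
  have h_eq: "second_fundamental_form X p (t y) (t z)
      = (fst y * fst z) *\<^sub>R L + (snd y * snd z) *\<^sub>R M" for y z
  proof -
    let ?D = "\<lambda>h. fst z *\<^sub>R (fst h *\<^sub>R A + snd h *\<^sub>R B) + snd z *\<^sub>R (fst h *\<^sub>R B' + snd h *\<^sub>R C)"
    have "((\<lambda>q. fst z *\<^sub>R Xu q + snd z *\<^sub>R Xv q) has_derivative ?D) (at p)"
      by (intro has_derivative_add has_derivative_scaleR_right dXu dXv)
    then have "((\<lambda>q. frechet_derivative X (at q) z) has_derivative ?D) (at p)"
      by (rule has_derivative_transform_within_open[OF _ U]) (simp add: fd)
    then have "frechet_derivative (\<lambda>q. frechet_derivative X (at q) z) (at p) = ?D"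
      by (rule frechet_derivative_at[symmetric])
    then have "second_fundamental_form X p (t y) (t z) = normal_part X p (?D y)"
      by (simp add: second_fundamental_form_def coords)
    also have "\<dots> = (fst y * fst z) *\<^sub>R L + (snd y * snd z) *\<^sub>R M"
    proof -
      have "normal_part X p B = 0" "normal_part X p B' = 0"
        using conjugate span_tangent by (auto intro!: normal_part_tangent diff)
      then show ?thesis
        by (simp add: linear_add[OF linear_normal_part[OF diff]]
            linear_scale[OF linear_normal_part[OF diff]] L_def M_def mult.commute)
    qed
    finally show ?thesis .
  qed
  have A_eq: "shape_operator X p N (t y) = t (fst y * inner L N / inner (Xu p) (Xu p),
      snd y * inner M N / inner (Xv p) (Xv p))" for y
  proof (rule shape_operator_unique[OF diff])
    fix W assume "W \<in> tangent_space_at X p"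
    then obtain w where "W = t w" by (auto simp: tangent)
    then show "inner (t (fst y * inner L N / inner (Xu p) (Xu p),
        snd y * inner M N / inner (Xv p) (Xv p))) W = inner (second_fundamental_form X p (t y) W) N"
      using regular by (simp add: inner_t h_eq inner_add_left)
  qed simp
  obtain y z where "Y = t y" "Z = t z"
    using Y Z by (auto simp: tangent)
  then show ?thesis
    by (simp add: normal_curvature_tensor_def A_eq h_eq mult_ac)
qed

section \<open>Surfaces spanned by an axis and a spherical curve\<close>

text \<open>
  The three maps \<open>X\<close>, \<open>X\<^sub>u\<close> and \<open>X\<^sub>v\<close> all have the shape treated here, the last one with \<open>a = 0\<close>
  and \<open>\<rho>'\<close> in place of \<open>\<rho>\<close>.
\<close>

lemma has_derivative_axis_curve:
  fixes \<rho> :: "real \<Rightarrow> 'a::real_normed_vector"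
  assumes "(a has_real_derivative a') (at (fst q))" "(b has_real_derivative b') (at (fst q))"
    and "(\<rho> has_vector_derivative \<rho>') (at (snd q))"
  shows "((\<lambda>q. a (fst q) *\<^sub>R e + b (fst q) *\<^sub>R \<rho> (snd q)) has_derivative
    (\<lambda>h. fst h *\<^sub>R (a' *\<^sub>R e + b' *\<^sub>R \<rho> (snd q)) + snd h *\<^sub>R (b (fst q) *\<^sub>R \<rho>'))) (at q)"
proof -
  note fst' = has_derivative_fst[OF has_derivative_ident, of "at q"]
  note snd' = has_derivative_snd[OF has_derivative_ident, of "at q"]
  have a: "((\<lambda>q. a (fst q)) has_derivative (\<lambda>h. a' * fst h)) (at q)"
    using has_derivative_compose[OF fst', of a "(*) a'"] assms(1)
    by (simp add: has_field_derivative_def)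
  have b: "((\<lambda>q. b (fst q)) has_derivative (\<lambda>h. b' * fst h)) (at q)"
    using has_derivative_compose[OF fst', of b "(*) b'"] assms(2)
    by (simp add: has_field_derivative_def)
  have r: "((\<lambda>q. \<rho> (snd q)) has_derivative (\<lambda>h. snd h *\<^sub>R \<rho>')) (at q)"
    using has_derivative_compose[OF snd', of \<rho> "\<lambda>h. h *\<^sub>R \<rho>'"] assms(3)
    by (simp add: has_vector_derivative_def)
  show ?thesis
    by (rule has_derivative_eq_rhs,
        rule has_derivative_add[OF has_derivative_scaleR_left[OF a] has_derivative_scaleR[OF b r]])
       (simp add: fun_eq_iff algebra_simps)
qed

lemma constant_inner_imp_derivative_zero:
  fixes f g :: "real \<Rightarrow> 'a::real_inner"
  assumes "open J" "v \<in> J" "\<And>v. v \<in> J \<Longrightarrow> inner (f v) (g v) = k"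
    and "(f has_vector_derivative f') (at v)" "(g has_vector_derivative g') (at v)"
  shows "inner (f v) g' + inner f' (g v) = 0"
proof -
  have "((\<lambda>v. inner (f v) (g v)) has_derivative
      (\<lambda>h. inner (f v) (h *\<^sub>R g') + inner (h *\<^sub>R f') (g v))) (at v)"
    using assms(4,5) unfolding has_vector_derivative_def by (rule has_derivative_inner)
  moreover have "((\<lambda>v. inner (f v) (g v)) has_derivative (\<lambda>h. 0)) (at v)"
    by (rule has_derivative_transform_within_open[OF has_derivative_const assms(1,2)])
       (use assms(3) in simp)
  ultimately have "(\<lambda>h. inner (f v) (h *\<^sub>R g') + inner (h *\<^sub>R f') (g v)) = (\<lambda>h. 0)"
    by (rule has_derivative_unique)
  then show ?thesis by (metis scaleR_one)
qed

text \<open>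
  The constancy of \<open>\<rho> \<bullet> \<rho>\<close> and of \<open>e \<bullet> \<rho>\<close> makes \<open>\<rho>'\<close> orthogonal to \<open>\<rho>\<close> and to \<open>e\<close>, hence to
  \<open>X\<^sub>u\<close>, which lies in their span. Conjugacy comes from dividing by \<open>b\<close>:
  \<open>X\<^sub>u\<^sub>v = (b' / b) X\<^sub>v\<close>.
\<close>

lemma flat_normal_connection_axis_curve:
  fixes e :: "'a::euclidean_space" and \<rho> \<rho>' \<rho>'' :: "real \<Rightarrow> 'a"
    and a a' a'' b b' b'' :: "real \<Rightarrow> real"
  assumes I: "open I" and J: "open J" and e: "e \<noteq> 0"
    and a: "\<And>u. u \<in> I \<Longrightarrow> (a has_real_derivative a' u) (at u)"
           "\<And>u. u \<in> I \<Longrightarrow> (a' has_real_derivative a'' u) (at u)"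
    and b: "\<And>u. u \<in> I \<Longrightarrow> (b has_real_derivative b' u) (at u)"
           "\<And>u. u \<in> I \<Longrightarrow> (b' has_real_derivative b'' u) (at u)"
    and \<rho>: "\<And>v. v \<in> J \<Longrightarrow> (\<rho> has_vector_derivative \<rho>' v) (at v)"
           "\<And>v. v \<in> J \<Longrightarrow> (\<rho>' has_vector_derivative \<rho>'' v) (at v)"
    and nonzero: "\<And>u. u \<in> I \<Longrightarrow> a' u \<noteq> 0" "\<And>u. u \<in> I \<Longrightarrow> b u \<noteq> 0" "\<And>v. v \<in> J \<Longrightarrow> \<rho>' v \<noteq> 0"
    and orth: "\<And>v. v \<in> J \<Longrightarrow> inner e (\<rho> v) = 0"
    and sphere: "\<And>v. v \<in> J \<Longrightarrow> norm (\<rho> v) = r"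
  shows "flat_normal_connection_on (I \<times> J) (\<lambda>q. a (fst q) *\<^sub>R e + b (fst q) *\<^sub>R \<rho> (snd q))"
  unfolding flat_normal_connection_on_def
proof (intro ballI)
  let ?X = "\<lambda>q. a (fst q) *\<^sub>R e + b (fst q) *\<^sub>R \<rho> (snd q)"
  let ?Xu = "\<lambda>q. a' (fst q) *\<^sub>R e + b' (fst q) *\<^sub>R \<rho> (snd q)"
  let ?Xv = "\<lambda>q. b (fst q) *\<^sub>R \<rho>' (snd q)"
  fix p Y Z N
  assume p: "p \<in> I \<times> J" and YZ: "Y \<in> tangent_space_at ?X p" "Z \<in> tangent_space_at ?X p"
  define u v where "u = fst p" and "v = snd p"
  have uv: "fst p = u" "snd p = v" "u \<in> I" "v \<in> J"
    using p by (auto simp: u_def v_def)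
  have e_orth: "inner e (\<rho>' v) = 0"
    using constant_inner_imp_derivative_zero[OF J uv(4), of "\<lambda>_. e" \<rho> 0 0 "\<rho>' v"] orth \<rho> uv
    by simp
  have "inner (\<rho> v) (\<rho> v) = r\<^sup>2" if "v \<in> J" for v
    using sphere[OF that] by (metis power2_norm_eq_inner)
  from constant_inner_imp_derivative_zero[OF J uv(4) this \<rho>(1)[OF uv(4)] \<rho>(1)[OF uv(4)]]
  have \<rho>_orth: "inner (\<rho> v) (\<rho>' v) = 0"
    by (simp add: inner_commute)
  show "normal_curvature_tensor ?X p Y Z N = 0"
  proof (rule orthogonal_conjugate_coordinates_imp_flat[OF open_Times[OF I J] p _ _ _ _ _ _ _ _ YZ])
    show "(?X has_derivative (\<lambda>h. fst h *\<^sub>R ?Xu q + snd h *\<^sub>R ?Xv q)) (at q)" if "q \<in> I \<times> J" for q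
      using that by (intro has_derivative_axis_curve a b \<rho>) auto
    show "(?Xu has_derivative (\<lambda>h. fst h *\<^sub>R (a'' u *\<^sub>R e + b'' u *\<^sub>R \<rho> v)
        + snd h *\<^sub>R (b' u *\<^sub>R \<rho>' v))) (at p)"
      using has_derivative_axis_curve[of a' "a'' u" p b' "b'' u" \<rho> "\<rho>' v" e] a b \<rho> uv
      by (simp add: uv)
    show "(?Xv has_derivative (\<lambda>h. fst h *\<^sub>R (b' u *\<^sub>R \<rho>' v)
        + snd h *\<^sub>R (b u *\<^sub>R \<rho>'' v))) (at p)"
      using has_derivative_axis_curve[of "\<lambda>_. 0" 0 p b "b' u" \<rho>' "\<rho>'' v" e] b \<rho> uv
      by (simp add: uv)
    show "?Xu p \<noteq> 0"
    proof
      assume "?Xu p = 0"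
      then have "inner e (?Xu p) = 0" by simp
      then show False using e nonzero(1)[OF uv(3)] orth[OF uv(4)] by (simp add: inner_add_right uv)
    qed
    show "?Xv p \<noteq> 0" using nonzero uv by simp
    show "inner (?Xu p) (?Xv p) = 0"
      by (simp add: uv inner_add_left e_orth \<rho>_orth)
    show mixed: "b' u *\<^sub>R \<rho>' v \<in> span {?Xu p, ?Xv p}"
    proof -
      have "b' u *\<^sub>R \<rho>' v = (b' u / b u) *\<^sub>R ?Xv p"
        using nonzero(2)[OF uv(3)] by (simp add: uv)
      then show ?thesis by (metis insertCI span_base span_scale)
    qed
    show "b' u *\<^sub>R \<rho>' v \<in> span {?Xu p, ?Xv p}" by (rule mixed)
  qed
qed

section \<open>Generalized spherical surfaces of second kind\<close>

theorem proposition14: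
  fixes c lam :: real and I J :: "real set"
    and \<phi> :: "real \<Rightarrow> real" and \<rho> :: "real \<Rightarrow> real^4"
    and X :: "real \<times> real \<Rightarrow> real^4"
  assumes "c \<noteq> 0" and "lam > 0"
    and "open I" and "is_interval I"
    and "\<And>u. u \<in> I \<Longrightarrow> cos (u / c) \<noteq> 0"
    and "\<And>u. u \<in> I \<Longrightarrow> 1 - lam\<^sup>2 / c\<^sup>2 * (sin (u / c))\<^sup>2 > 0"
    and "open J" and "is_interval J"
    and "smooth_curve_on J \<rho>"
    and "\<And>v. v \<in> J \<Longrightarrow> \<rho> v \<in> sphere 0 1 \<inter> span {axis 2 1, axis 3 1, axis 4 1}"
    and "\<And>v. v \<in> J \<Longrightarrow> norm (vector_derivative \<rho> (at v)) = 1"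
    and "\<And>u. u \<in> I \<Longrightarrow>
           (\<phi> has_real_derivative sqrt (1 - lam\<^sup>2 / c\<^sup>2 * (sin (u / c))\<^sup>2)) (at u)"
    and "X = generalized_spherical_surface_second_kind c lam \<phi> \<rho>"
  shows "flat_normal_connection_on (I \<times> J) X
    \<and> (\<forall>p \<in> I \<times> J. \<forall>X1 X2 N1 N2.
          orthonormal_pair_in (tangent_space_at X p) X1 X2 \<longrightarrow>
          orthonormal_pair_in (normal_space_at X p) N1 N2 \<longrightarrow>
          normal_curvature X p X1 X2 N1 N2 = 0)"
proof -
  note c = assms(1) and lam = assms(2) and I = assms(3) and cos_nz = assms(5)
    and radicand = assms(6) and J = assms(7) and smooth = assms(9) and \<rho>_in = assms(10)
    and unit_speed = assms(11) and d\<phi> = assms(12) and X = assms(13)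
  obtain D where D0: "\<And>v. v \<in> J \<Longrightarrow> D 0 v = \<rho> v"
    and D: "\<And>n v. v \<in> J \<Longrightarrow> (D n has_vector_derivative D (Suc n) v) (at v)"
    using smooth unfolding smooth_curve_on_def by blast
  have d\<rho>: "(\<rho> has_vector_derivative D 1 v) (at v)" if "v \<in> J" for v
    by (rule has_vector_derivative_transform_within_open[OF _ J that, of "D 0"])
       (use D[OF that, of 0] D0 in auto)
  have X_eq: "X = (\<lambda>q. \<phi> (fst q) *\<^sub>R axis 1 1 + (lam * cos (fst q / c)) *\<^sub>R \<rho> (snd q))"
    by (auto simp: X generalized_spherical_surface_second_kind_def)
  have flat: "flat_normal_connection_on (I \<times> J) X"
    unfolding X_eq
  proof (rule flat_normal_connection_axis_curve[OF I J, where \<rho>' = "D 1" and \<rho>'' = "D 2"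
        and a' = "\<lambda>u. sqrt (1 - lam\<^sup>2 / c\<^sup>2 * (sin (u / c))\<^sup>2)"
        and a'' = "\<lambda>u. - (lam\<^sup>2 / c\<^sup>2 * (2 * sin (u / c) * (cos (u / c) / c)))
          * (inverse (sqrt (1 - lam\<^sup>2 / c\<^sup>2 * (sin (u / c))\<^sup>2)) / 2)"
        and b' = "\<lambda>u. - (lam * sin (u / c) / c)" and b'' = "\<lambda>u. - (lam * cos (u / c) / c\<^sup>2)"
        and r = 1])
    show "axis 1 1 \<noteq> (0 :: real^4)" by (simp add: axis_eq_0_iff)
    fix u assume u: "u \<in> I"
    show "(\<phi> has_real_derivative sqrt (1 - lam\<^sup>2 / c\<^sup>2 * (sin (u / c))\<^sup>2)) (at u)"
      by (rule d\<phi>[OF u])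
    have "((\<lambda>u. 1 - lam\<^sup>2 / c\<^sup>2 * (sin (u / c))\<^sup>2) has_real_derivative
        - (lam\<^sup>2 / c\<^sup>2 * (2 * sin (u / c) * (cos (u / c) / c)))) (at u)"
      using c by (auto intro!: derivative_eq_intros simp: field_simps eval_nat_numeral)
    from DERIV_chain2[OF DERIV_real_sqrt[OF radicand[OF u]] this]
    show "((\<lambda>u. sqrt (1 - lam\<^sup>2 / c\<^sup>2 * (sin (u / c))\<^sup>2)) has_real_derivative
        - (lam\<^sup>2 / c\<^sup>2 * (2 * sin (u / c) * (cos (u / c) / c)))
          * (inverse (sqrt (1 - lam\<^sup>2 / c\<^sup>2 * (sin (u / c))\<^sup>2)) / 2)) (at u)"
      by (simp only: mult.commute)
    show "((\<lambda>u. lam * cos (u / c)) has_real_derivative - (lam * sin (u / c) / c)) (at u)"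
      using c by (auto intro!: derivative_eq_intros)
    show "((\<lambda>u. - (lam * sin (u / c) / c)) has_real_derivative - (lam * cos (u / c) / c\<^sup>2)) (at u)"
      using c by (auto intro!: derivative_eq_intros simp: power2_eq_square)
    show "sqrt (1 - lam\<^sup>2 / c\<^sup>2 * (sin (u / c))\<^sup>2) \<noteq> 0"
      by (rule less_imp_neq[OF real_sqrt_gt_zero[OF radicand[OF u]], symmetric])
    show "lam * cos (u / c) \<noteq> 0" using lam cos_nz[OF u] by simp
  next
    fix v assume v: "v \<in> J"
    show "(\<rho> has_vector_derivative D 1 v) (at v)" by (rule d\<rho>[OF v])
    show "(D 1 has_vector_derivative D 2 v) (at v)"
      using D[OF v, of 1] by (simp add: numeral_2_eq_2)
    show "D 1 v \<noteq> 0"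
      using unit_speed[OF v] vector_derivative_at[OF d\<rho>[OF v]] by auto
    show "norm (\<rho> v) = 1" using \<rho>_in[OF v] by simp
    have "orthogonal (axis 1 1) (\<rho> v)"
      by (rule orthogonal_to_span[of _ "{axis 2 1, axis 3 1, axis 4 1}"])
         (use \<rho>_in[OF v] in \<open>auto simp: orthogonal_def inner_axis_axis\<close>)
    then show "inner (axis 1 1) (\<rho> v) = 0" by (simp add: orthogonal_def)
  qed
  moreover have "normal_curvature X p X1 X2 N1 N2 = 0"
    if "p \<in> I \<times> J" "orthonormal_pair_in (tangent_space_at X p) X1 X2"
      "orthonormal_pair_in (normal_space_at X p) N1 N2" for p X1 X2 N1 N2
  proof -
    have "normal_curvature_tensor X p X1 X2 N1 = 0"
      using flat that unfolding flat_normal_connection_on_def orthonormal_pair_in_def by blast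
    then show ?thesis by (simp add: normal_curvature_def)
  qed
  ultimately show ?thesis by blast
qed

end
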